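(* Let $E,F,G$ be Banach spaces over the same field $\mathbb K\in\{\mathbb R,\mathbb C\}$ and let $U\subseteq E$ and $V\subseteq F$ be open sets. Assume that $g\colon U\to F$ is differentiable at $x\in U$ and that $g(x)\in V$. Further assume that $f\colon V\to G$ is differentiable at $g(x)$. Then $f\circ g$ is differentiable at $x$ and $D(f\circ g)(x)=Df\bigl(g(x)\bigr)Dg(x)$.
   Context: $\mathcal L(E,F)$ denotes the space of bounded linear operators from $E$ to $F$ with the operator norm. Differentiability (in the sense of Carathéodory): for $U\subseteq E$ open, $f\colon U\to F$ is differentiable at $x\in U$ if there exists a map $\Phi_x\colon U\to\mathcal L(E,F)$, continuous at $x$, such that $f(y)=f(x)+\Phi_x(y)(y-x)$ for all $y\in U$. Such a $\Phi_x$ is called a slope function of $f$ at $x$, and $Df(x):=\Phi_x(x)$ is the derivative of $f$ at $x$ (it does not depend on the choice of slope function). If $f$ is differentiable at $x$, then it is continuous at $x$. Convention: since $g$ is continuous at $x$ and $V$ is open, there is an open neighbourhood $W\subseteq U$ of $x$ with $g(W)\subseteq V$; differentiability of $f\circ g$ at $x$ refers to the map $f\circ g\colon W\to G$ for any such $W$. *)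

theory Defs
  imports "HOL-Analysis.Analysis"
begin

text \<open>
  The scalar fields: a type in this class is, up to an isometric field isomorphism, \<open>\<real>\<close> or \<open>\<complex>\<close>,
  so that a type variable of this class ranges exactly over the two cases.
\<close>

class real_or_complex_field = real_normed_field +
  assumes real_or_complex:
    "(\<exists>h :: 'a \<Rightarrow> real. bij h \<and> (\<forall>a b. h (a + b) = h a + h b) \<and>
        (\<forall>a b. h (a * b) = h a * h b) \<and> (\<forall>a. norm (h a) = norm a)) \<or>
     (\<exists>h :: 'a \<Rightarrow> complex. bij h \<and> (\<forall>a b. h (a + b) = h a + h b) \<and>
        (\<forall>a b. h (a * b) = h a * h b) \<and> (\<forall>a. norm (h a) = norm a))"

instance real :: real_or_complex_field
  by standard (intro disjI1 exI[of _ id], simp)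

instance complex :: real_or_complex_field
  by standard (intro disjI2 exI[of _ id], simp)

text \<open>
  Class \<open>banach\<close> only provides real Banach spaces; the scalar multiplication by \<open>\<bbbK>\<close> is a parameter.
  The last axiom says that the underlying real Banach space is the one obtained by restriction of
  scalars.  For scalar type \<^typ>\<open>real\<close> it forces \<open>scale = scaleR\<close>.
\<close>

locale banach_space_over = vector_space scale
  for scale :: "'k :: real_or_complex_field \<Rightarrow> 'e :: banach \<Rightarrow> 'e" +
  assumes norm_scale: "norm (scale a v) = norm a * norm v"
    and scale_of_real: "scale (of_real r) v = r *\<^sub>R v"

lemma banach_space_over_scaleR: "banach_space_over (scaleR :: real \<Rightarrow> 'e :: banach \<Rightarrow> 'e)"
  by unfold_locales (simp_all add: scaleR_add_left scaleR_add_right)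

lemma banach_space_over_times_complex: "banach_space_over ((*) :: complex \<Rightarrow> complex \<Rightarrow> complex)"
  by unfold_locales (simp_all only: distrib_left distrib_right mult.assoc mult_1 norm_mult scaleR_conv_of_real)

text \<open>
  \<open>\<L>(E,F)\<close>: the \<open>\<bbbK>\<close>-linear elements of the type of bounded real-linear operators,
  with the operator norm inherited from that type.
\<close>

definition bounded_operators ::
  "('k :: real_or_complex_field \<Rightarrow> 'e :: banach \<Rightarrow> 'e) \<Rightarrow> ('k \<Rightarrow> 'f :: banach \<Rightarrow> 'f) \<Rightarrow> ('e \<Rightarrow>\<^sub>L 'f) set"
  where "bounded_operators sE sF = {A. Vector_Spaces.linear sE sF (blinfun_apply A)}"

text \<open>
  Maps defined on \<open>U\<close> are total functions whose values outside \<open>U\<close> are irrelevant.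
\<close>

definition slope_function ::
  "('k :: real_or_complex_field \<Rightarrow> 'e :: banach \<Rightarrow> 'e) \<Rightarrow> ('k \<Rightarrow> 'f :: banach \<Rightarrow> 'f) \<Rightarrow>
   'e set \<Rightarrow> ('e \<Rightarrow> 'f) \<Rightarrow> 'e \<Rightarrow> ('e \<Rightarrow> ('e \<Rightarrow>\<^sub>L 'f)) \<Rightarrow> bool"
  where "slope_function sE sF U f x \<Phi> \<longleftrightarrow>
    (\<forall>y\<in>U. \<Phi> y \<in> bounded_operators sE sF) \<and>
    continuous (at x within U) \<Phi> \<and>
    (\<forall>y\<in>U. f y = f x + blinfun_apply (\<Phi> y) (y - x))"

definition caratheodory_differentiable ::
  "('k :: real_or_complex_field \<Rightarrow> 'e :: banach \<Rightarrow> 'e) \<Rightarrow> ('k \<Rightarrow> 'f :: banach \<Rightarrow> 'f) \<Rightarrow>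
   'e set \<Rightarrow> ('e \<Rightarrow> 'f) \<Rightarrow> 'e \<Rightarrow> bool"
  where "caratheodory_differentiable sE sF U f x \<longleftrightarrow> (\<exists>\<Phi>. slope_function sE sF U f x \<Phi>)"

definition caratheodory_deriv ::
  "('k :: real_or_complex_field \<Rightarrow> 'e :: banach \<Rightarrow> 'e) \<Rightarrow> ('k \<Rightarrow> 'f :: banach \<Rightarrow> 'f) \<Rightarrow>
   'e set \<Rightarrow> ('e \<Rightarrow> 'f) \<Rightarrow> 'e \<Rightarrow> ('e \<Rightarrow>\<^sub>L 'f)"
  where "caratheodory_deriv sE sF U f x = (THE A. \<exists>\<Phi>. slope_function sE sF U f x \<Phi> \<and> A = \<Phi> x)"

lemma slope_function_unique:
  assumes U: "open U" "x \<in> U"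
    and \<Phi>: "slope_function sE sF U f x \<Phi>" and \<Psi>: "slope_function sE sF U f x \<Psi>"
  shows "\<Phi> x = \<Psi> x"
proof (rule blinfun_eqI)
  fix v
  define p where "p = (\<lambda>t::real. x + t *\<^sub>R v)"
  have p: "(p \<longlongrightarrow> x) (at 0)"
    proof -
    have "(p \<longlongrightarrow> x + 0 *\<^sub>R v) (at 0)"
      unfolding p_def by (intro tendsto_intros)
    then show ?thesis by simp
  qed
  have inU: "eventually (\<lambda>t. p t \<in> U) (at 0)"
    using topological_tendstoD[OF p U] .
  have lim: "((\<lambda>t. blinfun_apply (H (p t)) v) \<longlongrightarrow> blinfun_apply (H x) v) (at 0)"
    if "slope_function sE sF U f x H" for H
  proof -
    have "isCont H x"
      using that at_within_open[OF U(2) U(1)] unfolding slope_function_def by metis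
    then have "((\<lambda>t. H (p t)) \<longlongrightarrow> H x) (at 0)"
      using p by (rule isCont_tendsto_compose)
    then show ?thesis by (intro tendsto_intros)
  qed
  have "eventually (\<lambda>t. blinfun_apply (\<Phi> (p t)) v = blinfun_apply (\<Psi> (p t)) v) (at 0)"
    using inU eventually_neq_at_within[of "0::real" 0 UNIV]
  proof eventually_elim
    case (elim t)
    then have "f (p t) = f x + blinfun_apply (\<Phi> (p t)) (p t - x)"
      "f (p t) = f x + blinfun_apply (\<Psi> (p t)) (p t - x)"
      using \<Phi> \<Psi> unfolding slope_function_def by blast+
    then have "blinfun_apply (\<Phi> (p t)) (p t - x) = blinfun_apply (\<Psi> (p t)) (p t - x)"
      by (metis add_left_cancel)
    then show ?case
      using elim(2) by (simp add: p_def blinfun.scaleR_right)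
  qed
  then have "((\<lambda>t. blinfun_apply (\<Psi> (p t)) v) \<longlongrightarrow> blinfun_apply (\<Phi> x) v) (at 0)"
    using lim[OF \<Phi>] by (rule tendsto_cong[THEN iffD1])
  then show "blinfun_apply (\<Phi> x) v = blinfun_apply (\<Psi> x) v"
    using lim[OF \<Psi>] by (rule tendsto_unique[rotated]) simp
qed

lemma caratheodory_deriv_eq:
  assumes "open U" "x \<in> U" "slope_function sE sF U f x \<Phi>"
  shows "caratheodory_deriv sE sF U f x = \<Phi> x"
  unfolding caratheodory_deriv_def
  using assms slope_function_unique by (intro the_equality) blast+

end

theory Submission
  imports Defs
begin

text \<open>
  A slope function turns differentiability into an identity, so the chain rule becomes a
  substitution.  If \<open>g y = g x + \<Phi> y (y - x)\<close> and \<open>f z = f (g x) + \<Psi> z (z - g x)\<close>, then putting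
  \<open>z = g y\<close> gives \<open>f (g y) = f (g x) + \<Psi> (g y) (\<Phi> y (y - x))\<close>,
  so that \<open>\<lambda>y. \<Psi> (g y) o\<^sub>L \<Phi> y\<close> is a candidate slope function of \<open>f \<circ> g\<close> at \<open>x\<close>
  (lemma \<open>slope_function_compose\<close>).  It takes its values in the \<open>\<bbbK>\<close>-linear operators because these
  are closed under composition, and it is continuous at \<open>x\<close> because \<open>g\<close> is
  (lemma \<open>slope_function_imp_continuous\<close>) and composition of operators is jointly continuous in the
  operator norm.  No remainder term has to be estimated.  The value of the candidate at \<open>x\<close> is
  \<open>\<Psi> (g x) o\<^sub>L \<Phi> x\<close>, and since derivatives do not depend on the slope function, this is the
  asserted formula.
\<close>

lemma bounded_operators_compose:
  assumes "B \<in> bounded_operators sF sG" and "A \<in> bounded_operators sE sF"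
  shows "B o\<^sub>L A \<in> bounded_operators sE sG"
proof -
  have "blinfun_apply (B o\<^sub>L A) = blinfun_apply B \<circ> blinfun_apply A"
    by (simp add: fun_eq_iff)
  then show ?thesis
    using assms Vector_Spaces.linear_compose unfolding bounded_operators_def by fastforce
qed

lemma slope_function_subset:
  assumes "slope_function sE sF U g x \<Phi>" and "W \<subseteq> U"
  shows "slope_function sE sF W g x \<Phi>"
  using assms continuous_within_subset unfolding slope_function_def by blast

text \<open>
  As \<open>y\<close> tends to \<open>x\<close>, the operators \<open>\<Phi> y\<close> converge and the vectors \<open>y - x\<close> tend to \<open>0\<close>; hence the
  increment \<open>\<Phi> y (y - x)\<close> tends to \<open>0\<close>.
\<close>

lemma slope_function_imp_continuous:
  assumes "slope_function sE sF U g x \<Phi>"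
  shows "continuous (at x within U) g"
proof -
  have "(\<Phi> \<longlongrightarrow> \<Phi> x) (at x within U)"
    using assms by (simp add: slope_function_def continuous_within)
  then have "((\<lambda>y. g x + blinfun_apply (\<Phi> y) (y - x)) \<longlongrightarrow> g x + blinfun_apply (\<Phi> x) (x - x))
      (at x within U)"
    by (intro tendsto_intros)
  moreover have "eventually (\<lambda>y. g x + blinfun_apply (\<Phi> y) (y - x) = g y) (at x within U)"
    using assms by (auto simp: slope_function_def eventually_at_filter)
  ultimately have "(g \<longlongrightarrow> g x + blinfun_apply (\<Phi> x) (x - x)) (at x within U)"
    by (rule Lim_transform_eventually)
  then show ?thesis
    by (simp add: continuous_within)
qed

lemma slope_function_compose:
  assumes \<Phi>: "slope_function sE sF W g x \<Phi>" and \<Psi>: "slope_function sF sG V f (g x) \<Psi>"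
    and gW: "g ` W \<subseteq> V"
  shows "slope_function sE sG W (f \<circ> g) x (\<lambda>y. \<Psi> (g y) o\<^sub>L \<Phi> y)"
  unfolding slope_function_def
proof (intro conjI ballI)
  fix y assume y: "y \<in> W"
  show "\<Psi> (g y) o\<^sub>L \<Phi> y \<in> bounded_operators sE sG"
    using y \<Phi> \<Psi> gW unfolding slope_function_def
    by (intro bounded_operators_compose[where sF = sF]) auto
  have "f (g y) = f (g x) + blinfun_apply (\<Psi> (g y)) (g y - g x)"
    using y \<Psi> gW unfolding slope_function_def by blast
  also have "g y - g x = blinfun_apply (\<Phi> y) (y - x)"
    using y \<Phi> unfolding slope_function_def by (metis add_diff_cancel_left')
  finally show "(f \<circ> g) y = (f \<circ> g) x + blinfun_apply (\<Psi> (g y) o\<^sub>L \<Phi> y) (y - x)"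
    by simp
next
  have "continuous (at (g x) within g ` W) \<Psi>"
    using \<Psi> gW continuous_within_subset unfolding slope_function_def by blast
  with slope_function_imp_continuous[OF \<Phi>] have "continuous (at x within W) (\<lambda>y. \<Psi> (g y))"
    by (rule continuous_within_compose2)
  moreover have "continuous (at x within W) \<Phi>"
    using \<Phi> by (simp add: slope_function_def)
  ultimately show "continuous (at x within W) (\<lambda>y. \<Psi> (g y) o\<^sub>L \<Phi> y)"
    by (rule bounded_bilinear.continuous[OF bounded_bilinear_blinfun_compose])
qed

lemma continuous_at_open_preimage_neighbourhood:
  assumes "open U" and "x \<in> U" and "continuous (at x within U) g" and "open V" and "g x \<in> V"
  shows "\<exists>W. open W \<and> x \<in> W \<and> W \<subseteq> U \<and> g ` W \<subseteq> V"
proof -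
  have "eventually (\<lambda>y. g y \<in> V) (at x within U)"
    using assms(3-5) by (auto simp: continuous_within dest: topological_tendstoD)
  then obtain S where "open S" "x \<in> S" "\<forall>y\<in>S. y \<noteq> x \<longrightarrow> y \<in> U \<longrightarrow> g y \<in> V"
    unfolding eventually_at_topological by blast
  then have "open (S \<inter> U) \<and> x \<in> S \<inter> U \<and> S \<inter> U \<subseteq> U \<and> g ` (S \<inter> U) \<subseteq> V"
    using assms by auto
  then show ?thesis ..
qed

theorem theorem3p2:
  fixes scaleE :: "'k :: real_or_complex_field \<Rightarrow> 'e :: banach \<Rightarrow> 'e"
    and scaleF :: "'k \<Rightarrow> 'f :: banach \<Rightarrow> 'f"
    and scaleG :: "'k \<Rightarrow> 'g :: banach \<Rightarrow> 'g"
    and U :: "'e set" and V :: "'f set"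
    and g :: "'e \<Rightarrow> 'f" and f :: "'f \<Rightarrow> 'g" and x :: 'e
  assumes "banach_space_over scaleE"
    and "banach_space_over scaleF"
    and "banach_space_over scaleG"
    and "open U" and "open V"
    and "x \<in> U" and "caratheodory_differentiable scaleE scaleF U g x"
    and "g x \<in> V" and "caratheodory_differentiable scaleF scaleG V f (g x)"
  shows "(\<exists>W. open W \<and> x \<in> W \<and> W \<subseteq> U \<and> g ` W \<subseteq> V) \<and>
    (\<forall>W. open W \<and> x \<in> W \<and> W \<subseteq> U \<and> g ` W \<subseteq> V \<longrightarrow>
      caratheodory_differentiable scaleE scaleG W (f \<circ> g) x \<and>
      caratheodory_deriv scaleE scaleG W (f \<circ> g) x =
        caratheodory_deriv scaleF scaleG V f (g x) o\<^sub>L caratheodory_deriv scaleE scaleF U g x)"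
proof -
  obtain \<Phi> where \<Phi>: "slope_function scaleE scaleF U g x \<Phi>"
    using assms(7) unfolding caratheodory_differentiable_def by blast
  obtain \<Psi> where \<Psi>: "slope_function scaleF scaleG V f (g x) \<Psi>"
    using assms(9) unfolding caratheodory_differentiable_def by blast
  have chain: "caratheodory_differentiable scaleE scaleG W (f \<circ> g) x \<and>
      caratheodory_deriv scaleE scaleG W (f \<circ> g) x =
        caratheodory_deriv scaleF scaleG V f (g x) o\<^sub>L caratheodory_deriv scaleE scaleF U g x"
    if W: "open W" "x \<in> W" "W \<subseteq> U" "g ` W \<subseteq> V" for W
  proof -
    have comp: "slope_function scaleE scaleG W (f \<circ> g) x (\<lambda>y. \<Psi> (g y) o\<^sub>L \<Phi> y)"
      using slope_function_subset[OF \<Phi> W(3)] \<Psi> W(4) by (rule slope_function_compose)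
    moreover have "caratheodory_deriv scaleE scaleG W (f \<circ> g) x = \<Psi> (g x) o\<^sub>L \<Phi> x"
      using W(1,2) comp by (rule caratheodory_deriv_eq)
    moreover have "caratheodory_deriv scaleF scaleG V f (g x) = \<Psi> (g x)"
      using assms(5,8) \<Psi> by (rule caratheodory_deriv_eq)
    moreover have "caratheodory_deriv scaleE scaleF U g x = \<Phi> x"
      using assms(4,6) \<Phi> by (rule caratheodory_deriv_eq)
    ultimately show ?thesis
      unfolding caratheodory_differentiable_def by auto
  qed
  have "\<exists>W. open W \<and> x \<in> W \<and> W \<subseteq> U \<and> g ` W \<subseteq> V"
    using assms(4,6) slope_function_imp_continuous[OF \<Phi>] assms(5,8)
    by (rule continuous_at_open_preimage_neighbourhood)
  with chain show ?thesis by blast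
qed

end
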